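(* Let $\tilde{A}^{(0)}=(A^{(0)},a^{(0)})\in\mathbb{R}^{k\times n}\times\mathbb{R}^k=\mathbb{R}^{k\times(n+1)}$, $\overline{\Delta}\in\mathbb{R}^{k\times(n+1)}$, $\rho\in\mathbb{R}$, $w^1,\ldots,w^l\in\mathbb{R}^{k(n+1)}$, $\beta^1,\ldots,\beta^l\in\mathbb{R}$, and let $$\mathcal{U}=\{\tilde{A}^{(0)}+\Delta:\ \Delta\in\mathbb{R}^{k\times(n+1)},\ \|\Delta-\overline{\Delta}\|_F\le\rho,\ (w^j)^T{\rm vec}(\Delta)\le\beta^j,\ j=1,\ldots,l\}.$$ Consider the robust least squares problem $$(RLSP)\quad \min_{x\in\mathbb{R}^n}\ \max_{(A,a)\in\mathcal{U}}\|Ax-a\|^2.$$ Assume that $k\ge s+1$, where $s={\rm dim}\,{\rm span}\{w^1,\ldots,w^l\}$, and that $\{\Delta\in\mathbb{R}^{k\times(n+1)}:\|\Delta-\overline{\Delta}\|_F<\rho,\ (w^j)^T{\rm vec}(\Delta)<\beta^j,\ j=1,\ldots,l\}\ne\emptyset$. Let $x\in\mathbb{R}^n$. Then $x$ solves $(RLSP)$ if and only if there exist $\lambda\in\mathbb{R}$ and $\lambda^0,\ldots,\lambda^l\ge 0$ such that $(x,\lambda,\lambda^0,\ldots,\lambda^l)$ solves the linear semidefinite programming problem of minimizing $\lambda$ over all $(x,\lambda)\in\mathbb{R}^n\times\mathbb{R}$ and $\lambda^0,\ldots,\lambda^l\ge 0$ satisfying $$\left(\begin{array}{ccc} I_k &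 I_k\otimes\tilde{x}^T & A^{(0)}x-a^{(0)}\\ (I_k\otimes\tilde{x}^T)^T & \lambda^0I_{k(n+1)} & -\lambda^0b+\frac12\sum_{j=1}^l\lambda^jw^j\\ (A^{(0)}x-a^{(0)})^T & \big(-\lambda^0b+\frac12\sum_{j=1}^l\lambda^jw^j\big)^T & \lambda-\lambda^0(\gamma-\|b\|^2)-\sum_{j=1}^l\lambda^j\beta^j\end{array}\right)\succeq 0,$$ where $\tilde{x}=(x^T,-1)^T\in\mathbb{R}^{n+1}$, $b={\rm vec}(\overline{\Delta})$ and $\gamma=\rho^2$.
   Context: $\|M\|_F=\sqrt{{\rm Tr}(M^TM)}$ is the Frobenius norm, $\|\cdot\|$ the Euclidean norm, and $B\succeq 0$ means $B$ is positive semidefinite. For $M\in\mathbb{R}^{k\times(n+1)}$, ${\rm vec}(M)\in\mathbb{R}^{k(n+1)}$ is the column vector obtained by stacking the (transposed) rows of $M$. $I_k\otimes\tilde{x}^T\in\mathbb{R}^{k\times k(n+1)}$ is the block-diagonal matrix with $k$ diagonal blocks each equal to the row vector $\tilde{x}^T$. "Solves" means "is a global optimal solution of". *)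

theory Defs
  imports "HOL-Analysis.Analysis"
begin

text \<open>
  The \<open>n + 1\<close> coordinates are indexed by the type \<open>'n option\<close>: \<open>Some j\<close> stands for one of the first
  \<open>n = CARD('n)\<close> coordinates and \<open>None\<close> for the last one. The \<open>k(n + 1)\<close> coordinates are indexed
  by \<open>'k \<times> 'n option\<close>, a pair \<open>(i, q)\<close> standing for position \<open>q\<close> inside the \<open>i\<close>-th block of
  length \<open>n + 1\<close>.
\<close>

definition frob_norm :: "real^'q^'k \<Rightarrow> real" where
  "frob_norm M = sqrt (trace (transpose M ** M))"

definition psd :: "real^'m^'m \<Rightarrow> bool" where
  "psd B \<longleftrightarrow> transpose B = B \<and> (\<forall>v. 0 \<le> v \<bullet> (B *v v))"

definition vec_rows :: "real^'q^'k \<Rightarrow> real^('k \<times> 'q)" where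
  "vec_rows M = (\<chi> p. M $ fst p $ snd p)"

definition augment :: "real^'n^'k \<Rightarrow> real^'k \<Rightarrow> real^('n option)^'k" where
  "augment A a = (\<chi> i q. case q of Some j \<Rightarrow> A $ i $ j | None \<Rightarrow> a $ i)"

definition xtilde :: "real^'n \<Rightarrow> real^('n option)" where
  "xtilde x = (\<chi> q. case q of Some j \<Rightarrow> x $ j | None \<Rightarrow> - 1)"

text \<open>The block-diagonal matrix \<open>I\<^sub>k \<otimes> y\<^sup>T\<close>.\<close>

definition id_kron_row :: "real^'q \<Rightarrow> real^('k \<times> 'q)^'k" where
  "id_kron_row y = (\<chi> i p. if i = fst p then y $ snd p else 0)"

definition uncertainty_set ::
  "real^('n::finite option)^'k \<Rightarrow> real^('n option)^'k \<Rightarrow> real \<Rightarrow> nat \<Rightarrow>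
   (nat \<Rightarrow> real^('k \<times> 'n option)) \<Rightarrow> (nat \<Rightarrow> real) \<Rightarrow> (real^('n option)^'k) set" where
  "uncertainty_set A0 Dbar \<rho> l w \<beta> =
     {A0 + D | D. frob_norm (D - Dbar) \<le> \<rho> \<and> (\<forall>j\<in>{1..l}. w j \<bullet> vec_rows D \<le> \<beta> j)}"

text \<open>
  The inner maximum of the robust problem is written as a supremum. The two agree whenever the
  uncertainty set is nonempty: that set is compact, and the residual is continuous in \<open>(A, a)\<close>.
\<close>

definition worst_case_residual :: "(real^('n option)^'k) set \<Rightarrow> real^'n \<Rightarrow> real" where
  "worst_case_residual U x = (SUP (A, a) \<in> {(A, a). augment A a \<in> U}. (norm (A *v x - a))\<^sup>2)"

definition solves_RLSP :: "(real^('n option)^'k) set \<Rightarrow> real^'n \<Rightarrow> bool" where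
  "solves_RLSP U x \<longleftrightarrow> is_arg_min (worst_case_residual U) (\<lambda>_. True) x"

text \<open>
  The symmetric matrix with block rows \<open>(P, Q, q)\<close>, \<open>(Q\<^sup>T, R, r)\<close> and \<open>(q\<^sup>T, r\<^sup>T, t)\<close>.
\<close>

definition sym_block3 ::
  "real^'k^'k \<Rightarrow> real^'m^'k \<Rightarrow> real^'k \<Rightarrow> real^'m^'m \<Rightarrow> real^'m \<Rightarrow> real \<Rightarrow>
   real^('k + 'm + unit)^('k + 'm + unit)" where
  "sym_block3 P Q q R r t = (\<chi> u v.
     (case u of
        Inl i \<Rightarrow> (case v of Inl i' \<Rightarrow> P $ i $ i' | Inr (Inl p') \<Rightarrow> Q $ i $ p' | Inr (Inr _) \<Rightarrow> q $ i)
      | Inr (Inl p) \<Rightarrow>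
          (case v of Inl i' \<Rightarrow> transpose Q $ p $ i' | Inr (Inl p') \<Rightarrow> R $ p $ p' | Inr (Inr _) \<Rightarrow> r $ p)
      | Inr (Inr _) \<Rightarrow>
          (case v of Inl i' \<Rightarrow> q $ i' | Inr (Inl p') \<Rightarrow> r $ p' | Inr (Inr _) \<Rightarrow> t)))"

text \<open>
  The multipliers \<open>\<lambda>\<^sup>0, \<dots>, \<lambda>\<^sup>l\<close> form a single function \<open>\<mu>\<close>, of which only the values at \<open>0, \<dots>, l\<close>
  matter.
\<close>

definition sdp_matrix ::
  "real^'n^'k \<Rightarrow> real^'k \<Rightarrow> real^('k \<times> 'n option) \<Rightarrow> real \<Rightarrow> nat \<Rightarrow>
   (nat \<Rightarrow> real^('k \<times> 'n option)) \<Rightarrow> (nat \<Rightarrow> real) \<Rightarrow> real^'n \<Rightarrow> real \<Rightarrow> (nat \<Rightarrow> real) \<Rightarrow>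
   real^('k + ('k \<times> 'n option) + unit)^('k + ('k \<times> 'n option) + unit)" where
  "sdp_matrix A0 a0 b \<gamma> l w \<beta> x lam \<mu> =
     sym_block3
       (mat 1) (id_kron_row (xtilde x)) (A0 *v x - a0)
       (\<mu> 0 *\<^sub>R mat 1) (- (\<mu> 0 *\<^sub>R b) + (1 / 2) *\<^sub>R (\<Sum>j = 1..l. \<mu> j *\<^sub>R w j))
       (lam - \<mu> 0 * (\<gamma> - (norm b)\<^sup>2) - (\<Sum>j = 1..l. \<mu> j * \<beta> j))"

definition sdp_feasible ::
  "real^'n^'k \<Rightarrow> real^'k \<Rightarrow> real^('k \<times> 'n option) \<Rightarrow> real \<Rightarrow> nat \<Rightarrow>
   (nat \<Rightarrow> real^('k \<times> 'n option)) \<Rightarrow> (nat \<Rightarrow> real) \<Rightarrow>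
   (real^'n) \<times> real \<times> (nat \<Rightarrow> real) \<Rightarrow> bool" where
  "sdp_feasible A0 a0 b \<gamma> l w \<beta> = (\<lambda>(x, lam, \<mu>).
     (\<forall>j\<in>{0..l}. 0 \<le> \<mu> j) \<and> psd (sdp_matrix A0 a0 b \<gamma> l w \<beta> x lam \<mu>))"

definition solves_SDP ::
  "real^'n^'k \<Rightarrow> real^'k \<Rightarrow> real^('k \<times> 'n option) \<Rightarrow> real \<Rightarrow> nat \<Rightarrow>
   (nat \<Rightarrow> real^('k \<times> 'n option)) \<Rightarrow> (nat \<Rightarrow> real) \<Rightarrow>
   (real^'n) \<times> real \<times> (nat \<Rightarrow> real) \<Rightarrow> bool" where
  "solves_SDP A0 a0 b \<gamma> l w \<beta> z \<longleftrightarrow>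
     is_arg_min (\<lambda>(x, lam, \<mu>). lam) (sdp_feasible A0 a0 b \<gamma> l w \<beta>) z"

end

theory Submission
  imports Defs
begin

text \<open>
  For fixed \<open>x\<close> let \<open>x'\<close> be \<open>x\<close> extended by \<open>-1\<close>, and put \<open>L = I\<^sub>k \<otimes> x'\<^sup>T\<close>
  and \<open>M = \<parallel>x'\<parallel>\<^sup>2 > 0\<close>, so that \<open>L L\<^sup>T = M I\<^sub>k\<close>. Adding \<open>M\<close> times
  the ball constraint to \<open>\<lambda> - \<parallel>L v + q\<parallel>\<^sup>2\<close> gives a convex quadratic \<open>h\<close> that is affine along each direction
  \<open>L\<^sup>T z\<close>. Since \<open>k > s\<close>, some \<open>L\<^sup>T z \<noteq> 0\<close> is orthogonal to all \<open>w\<^sup>j\<close>; moving along it in both senses until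
  the sphere is reached shows that \<open>h \<ge> 0\<close> on the feasible set as soon as \<open>\<lambda>\<close> bounds the residual there.
  Convex Lagrange multipliers for \<open>h\<close> then certify the bound \<open>\<lambda>\<close>, and a Schur complement turns the
  certificate into the semidefinite constraint.
\<close>

section \<open>Lagrange multipliers for convex inequalities\<close>

text \<open>Each \<open>v\<close> with \<open>g v > 0\<close> bounds the multiplier below by
  \<open>- f v / g v\<close>, and each \<open>u\<close> with \<open>g u < 0\<close> bounds it above
  by \<open>f u / (- g u)\<close>. Convexity puts every lower bound below every upper bound, so the
  supremum of the lower bounds works.\<close>

lemma convex_multiplier:
  fixes f g :: "'a::real_vector \<Rightarrow> real"
  assumes f: "convex_on C f" and g: "convex_on C g"
    and slater: "u0 \<in> C" "g u0 < 0"
    and nonneg: "\<And>v. v \<in> C \<Longrightarrow> g v \<le> 0 \<Longrightarrow> 0 \<le> f v"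
  shows "\<exists>\<nu>\<ge>0. \<forall>v\<in>C. 0 \<le> f v + \<nu> * g v"
proof -
  have cross: \<comment> \<open>evaluate at the point of the segment where the chord of \<open>g\<close> vanishes\<close>
    "- f v / g v \<le> f u / (- g u)"
    if u: "u \<in> C" "g u < 0" and v: "v \<in> C" "0 < g v" for u v
  proof -
    define t where "t = - g u / (g v - g u)"
    have t: "0 \<le> t" "t \<le> 1" "1 - t = g v / (g v - g u)"
      using u v by (auto simp: t_def field_simps)
    let ?z = "(1 - t) *\<^sub>R u + t *\<^sub>R v"
    have z: "?z \<in> C"
      using convexD_alt[OF convex_on_imp_convex[OF f]] u v t(1,2) by blast
    have "g ?z \<le> (1 - t) * g u + t * g v"
      using convex_onD[OF g t(1,2) u(1) v(1)] .
    also have "\<dots> = 0"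
      unfolding t(3) unfolding t_def using u v by (simp add: field_simps)
    finally have "0 \<le> f ?z"
      using nonneg z by blast
    also have "\<dots> \<le> (1 - t) * f u + t * f v"
      using convex_onD[OF f t(1,2) u(1) v(1)] .
    also have "\<dots> = (g v * f u - g u * f v) / (g v - g u)"
      unfolding t(3) unfolding t_def by (simp add: diff_divide_distrib)
    finally have "0 \<le> g v * f u - g u * f v"
      using u v by (simp add: zero_le_divide_iff)
    then show ?thesis
      using u v by (simp add: field_simps)
  qed
  \<comment> \<open>The inserted \<open>0\<close> makes \<open>S\<close> nonempty and
    \<open>Sup S\<close> nonnegative; it respects the upper bounds because \<open>f\<close> is
    nonnegative where \<open>g\<close> is negative.\<close>
  define S where "S = insert 0 ((\<lambda>v. - f v / g v) ` {v \<in> C. 0 < g v})"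
  have le: "s \<le> f u / (- g u)" if "s \<in> S" "u \<in> C" "g u < 0" for s u
    using that cross nonneg[of u] by (fastforce simp: S_def intro: divide_nonneg_neg)
  have bdd: "bdd_above S"
    using le slater by (meson bdd_above.I)
  show ?thesis
  proof (intro exI[of _ "Sup S"] conjI ballI)
    show "0 \<le> Sup S"
      by (rule cSup_upper[OF _ bdd]) (simp add: S_def)
    fix v assume v: "v \<in> C"
    consider "g v < 0" | "g v = 0" | "0 < g v" by linarith
    then show "0 \<le> f v + Sup S * g v"
    proof cases
      case 1
      have "Sup S \<le> f v / (- g v)"
        by (rule cSup_least) (use le v 1 in \<open>auto simp: S_def\<close>)
      then show ?thesis using 1 by (simp add: field_simps)
    next
      case 2
      then show ?thesis using nonneg v by simp
    next
      case 3
      have "- f v / g v \<le> Sup S"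
        by (rule cSup_upper[OF _ bdd]) (use v 3 in \<open>auto simp: S_def\<close>)
      then show ?thesis using 3 by (simp add: field_simps)
    qed
  qed
qed

lemma convex_on_sublevel_set:
  assumes "convex_on C g"
  shows "convex {v \<in> C. g v \<le> (c::real)}"
  unfolding convex_alt
proof (intro ballI allI impI)
  fix u v and t :: real
  assume u: "u \<in> {v \<in> C. g v \<le> c}" and v: "v \<in> {v \<in> C. g v \<le> c}" and t: "0 \<le> t \<and> t \<le> 1"
  have "g ((1 - t) *\<^sub>R u + t *\<^sub>R v) \<le> (1 - t) * g u + t * g v"
    using convex_onD[OF assms] u v t by simp
  also have "\<dots> \<le> c"
    using u v t by (intro convex_bound_le) auto
  finally show "(1 - t) *\<^sub>R u + t *\<^sub>R v \<in> {v \<in> C. g v \<le> c}"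
    using convexD_alt[OF convex_on_imp_convex[OF assms]] u v t by simp
qed

text \<open>Induction on the constraints: constraint \<open>i\<close> is priced on the convex set
  cut out by the others, and \<open>f + \<nu> * g i\<close> becomes the objective for the induction
  hypothesis on all of \<open>C\<close>. Hence \<open>f\<close> is generalized.\<close>

lemma convex_multipliers:
  fixes f :: "'a::real_vector \<Rightarrow> real" and g :: "'i \<Rightarrow> 'a \<Rightarrow> real"
  assumes "finite J" and "convex_on C f" and "\<And>j. j \<in> J \<Longrightarrow> convex_on C (g j)"
    and "u0 \<in> C" "\<And>j. j \<in> J \<Longrightarrow> g j u0 < 0"
    and "\<And>v. v \<in> C \<Longrightarrow> (\<forall>j\<in>J. g j v \<le> 0) \<Longrightarrow> 0 \<le> f v"
  shows "\<exists>\<mu>. (\<forall>j\<in>J. 0 \<le> \<mu> j) \<and> (\<forall>v\<in>C. 0 \<le> f v + (\<Sum>j\<in>J. \<mu> j * g j v))"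
  using assms
proof (induction J arbitrary: f rule: finite_induct)
  case empty
  then show ?case by simp
next
  case (insert i J)
  let ?C = "{v \<in> C. \<forall>j\<in>J. g j v \<le> 0}"
  have eq: "?C = C \<inter> (\<Inter>j\<in>J. {v \<in> C. g j v \<le> 0})" by auto
  have convC: "convex ?C"
    unfolding eq using insert.prems(1,2)
    by (intro convex_Int convex_INT) (auto simp: convex_on_imp_convex intro: convex_on_sublevel_set)
  have conv: "convex_on ?C h" if "convex_on C h" for h
    using that convC by (auto simp: convex_on_def)
  have "\<exists>\<nu>\<ge>0. \<forall>v\<in>?C. 0 \<le> f v + \<nu> * g i v"
    using insert.prems by (intro convex_multiplier[where ?u0.0 = u0] conv) (auto intro: less_imp_le)
  then obtain \<nu> where \<nu>: "0 \<le> \<nu>" "\<And>v. v \<in> ?C \<Longrightarrow> 0 \<le> f v + \<nu> * g i v" by blast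
  have "convex_on C (\<lambda>v. f v + \<nu> * g i v)"
    using insert.prems \<nu> by (intro convex_on_add convex_on_cmul) auto
  then obtain \<mu> where \<mu>: "\<forall>j\<in>J. 0 \<le> \<mu> j"
    "\<forall>v\<in>C. 0 \<le> f v + \<nu> * g i v + (\<Sum>j\<in>J. \<mu> j * g j v)"
    using insert.IH[of "\<lambda>v. f v + \<nu> * g i v"] insert.prems \<nu> by auto
  have "(\<Sum>j\<in>J. (\<mu>(i := \<nu>)) j * g j v) = (\<Sum>j\<in>J. \<mu> j * g j v)" for v
    using insert.hyps by (intro sum.cong) auto
  then show ?case
    using \<mu> \<nu> insert.hyps by (intro exI[of _ "\<mu>(i := \<nu>)"]) (auto simp: add.assoc)
qed

section \<open>Strong duality for the inner maximization\<close>

lemma norm_sq_add_scaleR: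
  fixes a b :: "'a::real_inner"
  shows "(norm (a + s *\<^sub>R b))\<^sup>2 = (norm a)\<^sup>2 + 2 * s * (b \<bullet> a) + s\<^sup>2 * (norm b)\<^sup>2"
  unfolding power2_norm_eq_inner
  by (simp add: inner_simps inner_commute algebra_simps power2_eq_square)

lemma norm_sq_convex_combination:
  fixes a b :: "'a::real_inner"
  shows "(norm ((1 - t) *\<^sub>R a + t *\<^sub>R b))\<^sup>2 =
    (1 - t) * (norm a)\<^sup>2 + t * (norm b)\<^sup>2 - t * (1 - t) * (norm (a - b))\<^sup>2"
  unfolding power2_norm_eq_inner
  by (simp add: inner_simps inner_commute algebra_simps power2_eq_square)

text \<open>The shifts \<open>b\<close> and \<open>q\<close> cancel in differences, so the convexity
  gap is \<open>t * (1 - t)\<close> times \<open>bound\<close> at \<open>u - v\<close>.\<close>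

lemma convex_on_norm_sq_affine_diff:
  fixes L :: "'a::real_inner \<Rightarrow> 'b::real_inner"
  assumes L: "linear L" and bound: "\<And>v. (norm (L v))\<^sup>2 \<le> M * (norm v)\<^sup>2"
  shows "convex_on UNIV (\<lambda>v. M * (norm (v - b))\<^sup>2 - (norm (L v + q))\<^sup>2)"
proof (rule convex_onI)
  fix t :: real and u v :: 'a assume t: "0 < t" "t < 1"
  let ?z = "(1 - t) *\<^sub>R u + t *\<^sub>R v"
  have "L ?z = (1 - t) *\<^sub>R L u + t *\<^sub>R L v"
    by (simp only: linear_add[OF L] linear_scale[OF L])
  then have eqs: "?z - b = (1 - t) *\<^sub>R (u - b) + t *\<^sub>R (v - b)"
    "L ?z + q = (1 - t) *\<^sub>R (L u + q) + t *\<^sub>R (L v + q)"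
    by (simp_all only:) (simp_all add: algebra_simps)
  have d: "(norm (L u - L v))\<^sup>2 \<le> M * (norm (u - v))\<^sup>2"
    using bound[of "u - v"] by (simp add: linear_diff[OF L])
  have "0 \<le> t * (1 - t) * (M * (norm (u - v))\<^sup>2 - (norm (L u - L v))\<^sup>2)"
    using t d by simp
  then show "M * (norm (?z - b))\<^sup>2 - (norm (L ?z + q))\<^sup>2 \<le>
    (1 - t) * (M * (norm (u - b))\<^sup>2 - (norm (L u + q))\<^sup>2) +
    t * (M * (norm (v - b))\<^sup>2 - (norm (L v + q))\<^sup>2)"
    unfolding eqs norm_sq_convex_combination by (simp add: algebra_simps)
qed auto

text \<open>The norm is at most \<open>r\<close> at \<open>s = 0\<close> and at least
  \<open>2 * r - r\<close> at \<open>s = 2 * r / norm d\<close>; the intermediate value theorem does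
  the rest.\<close>

lemma ray_meets_sphere:
  fixes u d :: "'a::real_normed_vector"
  assumes "norm u \<le> r" "d \<noteq> 0"
  shows "\<exists>s\<ge>0. norm (u + s *\<^sub>R d) = r"
proof -
  let ?s = "2 * r / norm d"
  have r: "0 \<le> r" using assms norm_ge_zero order_trans by blast
  have "norm (?s *\<^sub>R d) \<le> norm (u + ?s *\<^sub>R d) + norm u"
    using norm_triangle_ineq4[of "u + ?s *\<^sub>R d" u] by simp
  moreover have "norm (?s *\<^sub>R d) = 2 * r"
    using assms r by simp
  ultimately have "r \<le> norm (u + ?s *\<^sub>R d)"
    using assms by linarith
  moreover have "continuous_on {0..?s} (\<lambda>s. norm (u + s *\<^sub>R d))"
    by (intro continuous_intros)
  ultimately obtain s where "0 \<le> s" "norm (u + s *\<^sub>R d) = r"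
    using IVT'[of "\<lambda>s. norm (u + s *\<^sub>R d)" 0 r ?s] assms r by auto
  then show ?thesis by blast
qed

text \<open>The objective \<open>lam - (norm (L v + q))\<^sup>2\<close> is concave, so convex
  multipliers do not apply to it directly. They are applied to \<open>h\<close>, and the
  \<open>M\<close> spent on convexifying is finally counted into the ball multiplier.\<close>

lemma ball_polyhedron_multipliers:
  fixes L :: "'a::euclidean_space \<Rightarrow> 'b::euclidean_space" and w :: "'i \<Rightarrow> 'a"
  assumes L: "linear L" and coisometry: "\<And>z. L (adjoint L z) = M *\<^sub>R z" and M: "0 < M"
    and J: "finite J" and dim: "dim (span (w ` J)) < DIM('b)"
    and slater: "norm (v0 - b) < r" "\<And>j. j \<in> J \<Longrightarrow> w j \<bullet> v0 < \<beta> j"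
    and bound: "\<And>v. norm (v - b) \<le> r \<Longrightarrow> (\<forall>j\<in>J. w j \<bullet> v \<le> \<beta> j) \<Longrightarrow> (norm (L v + q))\<^sup>2 \<le> lam"
  shows "\<exists>\<nu>\<ge>0. \<exists>\<mu>. (\<forall>j\<in>J. 0 \<le> \<mu> j) \<and>
    (\<forall>v. 0 \<le> lam - (norm (L v + q))\<^sup>2 + \<nu> * ((norm (v - b))\<^sup>2 - r\<^sup>2) +
      (\<Sum>j\<in>J. \<mu> j * (w j \<bullet> v - \<beta> j)))"
proof -
  define h where "h v = lam - (norm (L v + q))\<^sup>2 + M * ((norm (v - b))\<^sup>2 - r\<^sup>2)" for v
  have norm_adj: "(norm (adjoint L z))\<^sup>2 = M * (norm z)\<^sup>2" for z
    by (simp add: power2_norm_eq_inner adjoint_works[OF L] coisometry)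
  \<comment> \<open>Cauchy-Schwarz for \<open>v \<bullet> adjoint L (L v)\<close> and
    \<open>norm_adj\<close>, after cancelling \<open>(norm (L v))\<^sup>2\<close>, give the bound
    that makes \<open>h\<close> convex.\<close>
  have norm_L: "(norm (L v))\<^sup>2 \<le> M * (norm v)\<^sup>2" for v
  proof (cases "L v = 0")
    case False
    have "(norm (L v))\<^sup>2 = v \<bullet> adjoint L (L v)"
      by (simp add: power2_norm_eq_inner adjoint_works[OF L])
    also have "\<dots> \<le> norm v * norm (adjoint L (L v))"
      by (rule norm_cauchy_schwarz)
    finally have "((norm (L v))\<^sup>2)\<^sup>2 \<le> (norm v * norm (adjoint L (L v)))\<^sup>2"
      by (rule power_mono) simp
    also have "\<dots> = (norm v)\<^sup>2 * (M * (norm (L v))\<^sup>2)"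
      by (simp add: power_mult_distrib norm_adj)
    finally have "(norm (L v))\<^sup>2 * (norm (L v))\<^sup>2 \<le> (M * (norm v)\<^sup>2) * (norm (L v))\<^sup>2"
      by (simp add: power2_eq_square algebra_simps)
    then show ?thesis
      by (rule mult_right_le_imp_le) (use False in simp)
  qed (use M in simp)
  \<comment> \<open>The vectors \<open>L (w j)\<close> do not span the codomain, so some
    \<open>z \<noteq> 0\<close> is orthogonal to all of them; by adjointness
    \<open>adjoint L z\<close> is orthogonal to every \<open>w j\<close>.\<close>
  have "dim (span (L ` span (w ` J))) < DIM('b)"
    using dim_image_le[OF L, of "span (w ` J)"] dim by simp
  then have "dim (L ` span (w ` J)) < DIM('b)" by simp
  then obtain z where z: "z \<noteq> 0" "\<And>y. y \<in> span (L ` span (w ` J)) \<Longrightarrow> orthogonal z y"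
    using orthogonal_to_subspace_exists by blast
  define d where "d = adjoint L z"
  have d0: "d \<noteq> 0"
    using norm_adj[of z] z M by (auto simp: d_def)
  have wd: "w j \<bullet> d = 0" if "j \<in> J" for j
    using z(2)[of "L (w j)"] that
    by (auto simp: d_def adjoint_works[OF L] orthogonal_def inner_commute span_base)
  \<comment> \<open>The two terms quadratic in \<open>s\<close> are both
    \<open>M\<^sup>2 * s\<^sup>2 * (norm z)\<^sup>2\<close>, with opposite signs.\<close>
  have h_line: "h (v + s *\<^sub>R d) = h v + s * (2 * M * (d \<bullet> (v - b)) - 2 * M * (z \<bullet> (L v + q)))" for v s
  proof -
    have "L (v + s *\<^sub>R d) + q = (L v + q) + (s * M) *\<^sub>R z"
      by (simp add: linear_add[OF L] linear_scale[OF L] d_def coisometry)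
    then have 1: "(norm (L (v + s *\<^sub>R d) + q))\<^sup>2 =
        (norm (L v + q))\<^sup>2 + 2 * (s * M) * (z \<bullet> (L v + q)) + (s * M)\<^sup>2 * (norm z)\<^sup>2"
      by (simp only: norm_sq_add_scaleR)
    have "v + s *\<^sub>R d - b = (v - b) + s *\<^sub>R d" by simp
    then have 2: "(norm (v + s *\<^sub>R d - b))\<^sup>2 =
        (norm (v - b))\<^sup>2 + 2 * s * (d \<bullet> (v - b)) + s\<^sup>2 * (M * (norm z)\<^sup>2)"
      by (simp only: norm_sq_add_scaleR) (simp add: d_def norm_adj)
    show ?thesis
      unfolding h_def 1 2 by (simp add: algebra_simps power2_eq_square)
  qed
  have h_nonneg: "0 \<le> h v" if v: "norm (v - b) \<le> r" "\<forall>j\<in>J. w j \<bullet> v \<le> \<beta> j" for v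
  proof -
    define c where "c = 2 * M * (d \<bullet> (v - b)) - 2 * M * (z \<bullet> (L v + q))"
    \<comment> \<open>On the sphere the added ball term vanishes, so \<open>bound\<close> applies;
      moving along \<open>d\<close> preserves the linear constraints.\<close>
    have sphere: "0 \<le> h (v + s *\<^sub>R d)" if "norm (v - b + s *\<^sub>R d) = r" for s
    proof -
      have "norm (v + s *\<^sub>R d - b) = r" using that by (simp add: algebra_simps)
      moreover have "\<forall>j\<in>J. w j \<bullet> (v + s *\<^sub>R d) \<le> \<beta> j"
        using v wd by (simp add: inner_simps)
      ultimately show ?thesis
        using bound[of "v + s *\<^sub>R d"] by (simp add: h_def)
    qed
    obtain s where "0 \<le> s" "norm (v - b + s *\<^sub>R d) = r"
      using ray_meets_sphere[OF v(1) d0] by blast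
    moreover obtain s' where "0 \<le> s'" "norm (v - b + (- s') *\<^sub>R d) = r"
      using ray_meets_sphere[OF v(1), of "- d"] d0 by auto
    ultimately have "0 \<le> h v + s * c" "0 \<le> h v - s' * c" "0 \<le> s" "0 \<le> s'"
      using sphere[of s] sphere[of "- s'"] by (simp_all only: h_line c_def) simp_all
    \<comment> \<open>An affine function that is nonnegative at \<open>s\<close> and at
      \<open>- s'\<close> is nonnegative at \<open>0\<close>, which lies between them.\<close>
    then show ?thesis
      by (cases "0 \<le> c") (smt (verit) mult_nonneg_nonneg mult_nonneg_nonpos)+
  qed
  \<comment> \<open>The option index adjoins the ball, in squared and hence convex form, to the
    half-spaces, so that all constraints are priced together.\<close>
  define g where "g i v = (case i of None \<Rightarrow> (norm (v - b))\<^sup>2 - r\<^sup>2 | Some j \<Rightarrow> w j \<bullet> v - \<beta> j)" for i v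
  have r: "0 < r" using slater(1) norm_ge_zero le_less_trans by blast
  have g_ball: "g None v \<le> 0 \<longleftrightarrow> norm (v - b) \<le> r" for v
    using r by (simp add: g_def)
  have convh: "convex_on UNIV h"
  proof -
    have "h = (\<lambda>v. (M * (norm (v - b))\<^sup>2 - (norm (L v + q))\<^sup>2) + (lam - M * r\<^sup>2))"
      by (auto simp: h_def algebra_simps)
    then show ?thesis
      using convex_on_norm_sq_affine_diff[OF L norm_L]
      by (auto intro!: convex_on_add simp: convex_on_const)
  qed
  have convg: "convex_on UNIV (g i)" for i
  proof (cases i)
    case None
    \<comment> \<open>The squared norm is the case \<open>L = 0\<close>, \<open>M = 1\<close> of the
      convexity lemma.\<close>
    have "convex_on UNIV (\<lambda>v. 1 * (norm (v - b))\<^sup>2 - (norm ((0::real) + 0))\<^sup>2)"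
      by (rule convex_on_norm_sq_affine_diff[where L = "\<lambda>_. 0"]) (auto simp: linear_zero)
    then have "convex_on UNIV (\<lambda>v. (norm (v - b))\<^sup>2 + (- r\<^sup>2))"
      by (intro convex_on_add) (auto simp: convex_on_const)
    then show ?thesis by (simp add: None g_def[abs_def])
  next
    case (Some j)
    show ?thesis
      by (rule convex_onI) (auto simp: Some g_def inner_simps algebra_simps)
  qed
  have "\<exists>\<mu>. (\<forall>i\<in>insert None (Some ` J). 0 \<le> \<mu> i) \<and>
    (\<forall>v\<in>UNIV. 0 \<le> h v + (\<Sum>i\<in>insert None (Some ` J). \<mu> i * g i v))"
  proof (rule convex_multipliers[where ?u0.0 = v0])
    show "g i v0 < 0" if "i \<in> insert None (Some ` J)" for i
      using that slater r by (auto simp: g_def power_strict_mono)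
    show "0 \<le> h v" if "\<forall>i\<in>insert None (Some ` J). g i v \<le> 0" for v
      using that h_nonneg[of v] g_ball[of v] by (auto simp: g_def)
  qed (use J convh convg in auto)
  then obtain \<mu> where \<mu>: "\<forall>i\<in>insert None (Some ` J). 0 \<le> \<mu> i"
    "\<And>v. 0 \<le> h v + (\<Sum>i\<in>insert None (Some ` J). \<mu> i * g i v)" by blast
  have "(\<Sum>i\<in>insert None (Some ` J). \<mu> i * g i v) =
    \<mu> None * ((norm (v - b))\<^sup>2 - r\<^sup>2) + (\<Sum>j\<in>J. \<mu> (Some j) * (w j \<bullet> v - \<beta> j))" for v
    using J by (simp add: g_def sum.reindex image_iff)
  then have "0 \<le> lam - (norm (L v + q))\<^sup>2 + (M + \<mu> None) * ((norm (v - b))\<^sup>2 - r\<^sup>2) +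
      (\<Sum>j\<in>J. \<mu> (Some j) * (w j \<bullet> v - \<beta> j))" for v
    using \<mu>(2)[of v] by (simp only: h_def distrib_right)
  then show ?thesis
    using \<mu>(1) M
    by (intro exI[of _ "M + \<mu> None"] conjI exI[of _ "\<lambda>j. \<mu> (Some j)"]) auto
qed

section \<open>The semidefinite constraint\<close>

lemma sum_UNIV_sum_type:
  fixes f :: "'a::finite + 'b::finite \<Rightarrow> 'c::comm_monoid_add"
  shows "sum f UNIV = (\<Sum>a\<in>UNIV. f (Inl a)) + (\<Sum>b\<in>UNIV. f (Inr b))"
  unfolding UNIV_Plus_UNIV[symmetric] by (subst sum.Plus) auto

definition vec3 :: "real^'k \<Rightarrow> real^'m \<Rightarrow> real \<Rightarrow> real^('k + 'm + unit)" where
  "vec3 u v t = (\<chi> s. case s of Inl i \<Rightarrow> u $ i | Inr (Inl p) \<Rightarrow> v $ p | Inr (Inr _) \<Rightarrow> t)"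

lemma vec3_surj: "\<exists>u v t. z = vec3 u v t"
proof (intro exI)
  show "z = vec3 (\<chi> i. z $ Inl i) (\<chi> p. z $ Inr (Inl p)) (z $ Inr (Inr ()))"
    by (simp add: vec3_def vec_eq_iff split: sum.split)
qed

lemma inner_vec3: "vec3 u v t \<bullet> vec3 u' v' t' = u \<bullet> u' + v \<bullet> v' + t * t'"
  by (simp add: inner_vec_def vec3_def sum_UNIV_sum_type UNIV_unit)

lemma sym_block3_mult_vec3:
  "sym_block3 P Q q R r s *v vec3 u v t =
    vec3 (P *v u + Q *v v + t *\<^sub>R q) (transpose Q *v u + R *v v + t *\<^sub>R r) (q \<bullet> u + r \<bullet> v + s * t)"
  by (auto simp: vec_eq_iff matrix_vector_mult_def sym_block3_def vec3_def sum_UNIV_sum_type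
      UNIV_unit inner_vec_def split: sum.split)

lemma transpose_sym_block3:
  assumes "transpose P = P" "transpose R = R"
  shows "transpose (sym_block3 P Q q R r s) = sym_block3 P Q q R r s"
proof -
  have "P $ i $ j = P $ j $ i" "R $ a $ b = R $ b $ a" for i j a b
    using assms by (auto simp: transpose_def vec_eq_iff)
  then show ?thesis
    by (auto simp: transpose_def sym_block3_def vec_eq_iff split: sum.split)
qed

text \<open>Completing the square in the first block leaves a quadratic form in
  \<open>(v, t)\<close>, the homogenization of \<open>?\<phi>\<close>.\<close>

lemma psd_sym_block3_Schur:
  "psd (sym_block3 (mat 1) Q q (c *\<^sub>R mat 1) r s) \<longleftrightarrow>
    (\<forall>v. 0 \<le> c * (norm v)\<^sup>2 + 2 * (r \<bullet> v) + s - (norm (Q *v v + q))\<^sup>2)"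
  (is "psd ?B \<longleftrightarrow> (\<forall>v. 0 \<le> ?\<phi> v)")
proof -
  have form: "vec3 u v t \<bullet> (?B *v vec3 u v t) = (norm (u + (Q *v v + t *\<^sub>R q)))\<^sup>2 +
      (c * (norm v)\<^sup>2 + 2 * t * (r \<bullet> v) + s * t\<^sup>2 - (norm (Q *v v + t *\<^sub>R q))\<^sup>2)" for u v t
  proof -
    have Qt: "v \<bullet> (transpose Q *v u) = u \<bullet> (Q *v v)"
      by (metis dot_lmul_matrix inner_commute transpose_matrix_vector)
    have "(norm (u + (Q *v v + t *\<^sub>R q)))\<^sup>2 =
      u \<bullet> u + 2 * (u \<bullet> (Q *v v + t *\<^sub>R q)) + (norm (Q *v v + t *\<^sub>R q))\<^sup>2"
      using norm_sq_add_scaleR[of u 1 "Q *v v + t *\<^sub>R q"]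
      by (simp add: power2_norm_eq_inner inner_commute)
    moreover have "(c *\<^sub>R mat 1) *v v = c *\<^sub>R v"
      by (simp add: scaleR_matrix_vector_assoc[symmetric])
    ultimately show ?thesis
      unfolding sym_block3_mult_vec3 inner_vec3 matrix_vector_mul_lid
      by (simp only: inner_add_right inner_scaleR_right Qt power2_norm_eq_inner[of v])
         (simp add: inner_commute power2_eq_square algebra_simps)
  qed
  have sym: "transpose ?B = ?B"
    by (intro transpose_sym_block3) (auto simp: transpose_mat transpose_scalar)
  have "psd ?B \<longleftrightarrow> (\<forall>u v t. 0 \<le> vec3 u v t \<bullet> (?B *v vec3 u v t))"
    unfolding psd_def by (simp add: sym) (metis vec3_surj)
  also have "\<dots> \<longleftrightarrow> (\<forall>v. 0 \<le> ?\<phi> v)"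
  proof
    assume *: "\<forall>u v t. 0 \<le> vec3 u v t \<bullet> (?B *v vec3 u v t)"
    show "\<forall>v. 0 \<le> ?\<phi> v"
    proof
      fix v
      \<comment> \<open>The first block is chosen to make the square in \<open>form\<close> vanish,
        and \<open>t = 1\<close> dehomogenizes.\<close>
      show "0 \<le> ?\<phi> v"
        using *[rule_format, of "- (Q *v v + 1 *\<^sub>R q)" v 1] unfolding form by simp
    qed
  next
    assume *: "\<forall>v. 0 \<le> ?\<phi> v"
    have hom: "0 \<le> c * (norm v)\<^sup>2 + 2 * t * (r \<bullet> v) + s * t\<^sup>2 - (norm (Q *v v + t *\<^sub>R q))\<^sup>2"
      (is "0 \<le> ?\<psi> t") if "t \<noteq> 0" for v t
    proof -
      have "Q *v v + t *\<^sub>R q = t *\<^sub>R (Q *v ((1/t) *\<^sub>R v) + q)"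
        using that by (simp add: matrix_vector_mult_scaleR scaleR_add_right)
      then have "(norm (Q *v v + t *\<^sub>R q))\<^sup>2 = t\<^sup>2 * (norm (Q *v ((1/t) *\<^sub>R v) + q))\<^sup>2"
        by (simp only: norm_scaleR power_mult_distrib power2_abs)
      moreover have "t\<^sup>2 * (c * (norm ((1/t) *\<^sub>R v))\<^sup>2 + 2 * (r \<bullet> ((1/t) *\<^sub>R v)) + s) =
          c * (norm v)\<^sup>2 + 2 * t * (r \<bullet> v) + s * t\<^sup>2"
        using that by (simp add: power_divide field_simps power2_eq_square)
      ultimately have "?\<psi> t = t\<^sup>2 * ?\<phi> ((1/t) *\<^sub>R v)"
        by (simp only: right_diff_distrib)
      then show ?thesis
        using *[rule_format, of "(1/t) *\<^sub>R v"] by (simp only:) (rule mult_nonneg_nonneg, simp_all)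
    qed
    have "0 \<le> c * (norm v)\<^sup>2 + 2 * t * (r \<bullet> v) + s * t\<^sup>2 - (norm (Q *v v + t *\<^sub>R q))\<^sup>2"
      (is "0 \<le> ?\<psi> t") for v t
    proof (cases "t = 0")
      case True
      \<comment> \<open>Rescaling divides by \<open>t\<close>, so the value at \<open>t = 0\<close>
        is reached as a limit of nonnegative values.\<close>
      have "(?\<psi> \<longlongrightarrow> ?\<psi> 0) (at 0)"
        by (intro tendsto_intros)
      then have "0 \<le> ?\<psi> 0"
        by (rule tendsto_lowerbound) (use hom in \<open>auto simp: eventually_at_filter intro!: always_eventually\<close>)
      then show ?thesis using True by simp
    qed (rule hom)
    then show "\<forall>u v t. 0 \<le> vec3 u v t \<bullet> (?B *v vec3 u v t)"
      unfolding form by (simp add: add_nonneg_nonneg)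
  qed
  finally show ?thesis .
qed

text \<open>The quadratic form doubles the off-diagonal column, hence the factor
  \<open>1 / 2\<close> at the \<open>w j\<close>; \<open>(norm b)\<^sup>2\<close> in the corner
  completes \<open>(norm (v - b))\<^sup>2\<close>. The constraint says that the Lagrangian is
  nonnegative everywhere.\<close>

lemma psd_sdp_matrix_iff:
  "psd (sdp_matrix A0 a0 b \<gamma> l w \<beta> x lam \<mu>) \<longleftrightarrow>
    (\<forall>v. 0 \<le> lam - (norm (id_kron_row (xtilde x) *v v + (A0 *v x - a0)))\<^sup>2
      + \<mu> 0 * ((norm (v - b))\<^sup>2 - \<gamma>) + (\<Sum>j = 1..l. \<mu> j * (w j \<bullet> v - \<beta> j)))"
proof -
  have sq: "(norm (v - b))\<^sup>2 = (norm v)\<^sup>2 - 2 * (b \<bullet> v) + (norm b)\<^sup>2" for v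
    by (simp add: power2_norm_eq_inner inner_diff_left inner_diff_right inner_commute)
  show ?thesis
    unfolding sdp_matrix_def psd_sym_block3_Schur sq
    by (simp add: inner_diff_left inner_add_left inner_sum_left sum_subtractf algebra_simps)
qed

section \<open>The robust problem in vectorized form\<close>

definition unvec_rows :: "real^('k \<times> 'q) \<Rightarrow> real^'q^'k" where
  "unvec_rows v = (\<chi> i q. v $ (i, q))"

lemma vec_rows_unvec_rows [simp]: "vec_rows (unvec_rows v) = v"
  by (simp add: vec_rows_def unvec_rows_def vec_eq_iff)

lemma vec_rows_diff: "vec_rows (M - N) = vec_rows M - vec_rows N"
  by (simp add: vec_rows_def vec_eq_iff)

lemma sum_UNIV_prod: "(\<Sum>p\<in>UNIV. f p) = (\<Sum>i\<in>UNIV. \<Sum>q\<in>UNIV. f (i, q))"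
  by (simp add: sum.cartesian_product)

lemma frob_norm_eq_norm_vec_rows: "frob_norm M = norm (vec_rows M)"
proof -
  have "trace (transpose M ** M) = vec_rows M \<bullet> vec_rows M"
    unfolding trace_def matrix_matrix_mult_def transpose_def vec_rows_def inner_vec_def sum_UNIV_prod
    by simp (rule sum.swap)
  then show ?thesis
    by (simp add: frob_norm_def norm_eq_sqrt_inner)
qed

lemma id_kron_row_mult_vec:
  "(id_kron_row y *v v) $ i = (\<Sum>q\<in>UNIV. y $ q * v $ (i, q))"
proof -
  have "(id_kron_row y *v v) $ i = (\<Sum>j\<in>UNIV. \<Sum>q\<in>UNIV. (if i = j then y $ q else 0) * v $ (j, q))"
    by (simp add: matrix_vector_mult_def id_kron_row_def sum_UNIV_prod cong: if_cong)
  also have "\<dots> = (\<Sum>j\<in>UNIV. if i = j then \<Sum>q\<in>UNIV. y $ q * v $ (j, q) else 0)"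
    by (intro sum.cong) auto
  finally show ?thesis by simp
qed

lemma id_kron_row_mult_vec_rows: "id_kron_row y *v vec_rows D = D *v y"
  unfolding vec_eq_iff id_kron_row_mult_vec
  by (simp add: vec_rows_def matrix_vector_mult_def mult.commute)

text \<open>The rows have disjoint supports and common norm \<open>norm y\<close>. This is the
  coisometry hypothesis of the duality lemma, with \<open>M = (norm y)\<^sup>2\<close>.\<close>

lemma id_kron_row_mult_transpose:
  "id_kron_row y *v (transpose (id_kron_row y) *v z) = (norm y)\<^sup>2 *\<^sub>R z"
proof -
  have "(transpose (id_kron_row y) *v z) $ (i, q) = y $ q * z $ i" for i q
    by (simp add: matrix_vector_mult_def transpose_def id_kron_row_def if_distrib if_distribR
        cong: if_cong)
  then show ?thesis
    by (simp add: vec_eq_iff id_kron_row_mult_vec power2_norm_eq_inner inner_vec_def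
        sum_distrib_right mult.assoc)
qed

lemma sum_UNIV_option:
  fixes f :: "'a::finite option \<Rightarrow> 'c::comm_monoid_add"
  shows "sum f UNIV = f None + (\<Sum>a\<in>UNIV. f (Some a))"
  by (simp add: UNIV_option_conv sum.reindex image_iff)

lemma augment_mult_xtilde: "augment A a *v xtilde x = A *v x - a"
  by (simp add: vec_eq_iff matrix_vector_mult_def augment_def xtilde_def sum_UNIV_option)

lemma augment_surj: "\<exists>A a. M = augment A a"
proof (intro exI)
  show "M = augment (\<chi> i j. M $ i $ Some j) (\<chi> i. M $ i $ None)"
    by (simp add: augment_def vec_eq_iff split: option.split)
qed

lemma xtilde_nonzero: "xtilde x \<noteq> 0"
  by (auto simp: xtilde_def vec_eq_iff intro!: exI[of _ None])

text \<open>Both suprema are over the same set of values: \<open>augment\<close> reaches every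
  matrix, \<open>unvec_rows\<close> inverts \<open>vec_rows\<close>, and the residual is linear in
  the data matrix.\<close>

lemma worst_case_residual_vectorized:
  "worst_case_residual (uncertainty_set (augment A0 a0) Dbar \<rho> l w \<beta>) x =
    (SUP v \<in> {v. norm (v - vec_rows Dbar) \<le> \<rho> \<and> (\<forall>j\<in>{1..l}. w j \<bullet> v \<le> \<beta> j)}.
      (norm (id_kron_row (xtilde x) *v v + (A0 *v x - a0)))\<^sup>2)"
  (is "_ = (SUP v \<in> ?V. ?F v)")
proof -
  let ?U = "uncertainty_set (augment A0 a0) Dbar \<rho> l w \<beta>"
  have U: "?U = (\<lambda>v. augment A0 a0 + unvec_rows v) ` ?V"
  proof (intro equalityI subsetI)
    fix M assume "M \<in> ?U"
    then obtain D where D: "M = augment A0 a0 + D" "vec_rows D \<in> ?V"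
      by (auto simp: uncertainty_set_def frob_norm_eq_norm_vec_rows vec_rows_diff)
    moreover have "unvec_rows (vec_rows D) = D"
      by (simp add: unvec_rows_def vec_rows_def vec_eq_iff)
    ultimately show "M \<in> (\<lambda>v. augment A0 a0 + unvec_rows v) ` ?V"
      by (metis (mono_tags, lifting) image_eqI)
  qed (auto simp: uncertainty_set_def frob_norm_eq_norm_vec_rows vec_rows_diff)
  have "(\<lambda>(A, a). (norm (A *v x - a))\<^sup>2) ` {(A, a). augment A a \<in> ?U} =
    (\<lambda>M. (norm (M *v xtilde x))\<^sup>2) ` ?U"
  proof (intro equalityI subsetI)
    fix c assume "c \<in> (\<lambda>M. (norm (M *v xtilde x))\<^sup>2) ` ?U"
    then obtain M where M: "M \<in> ?U" "c = (norm (M *v xtilde x))\<^sup>2" by blast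
    obtain A a where "M = augment A a" using augment_surj by blast
    with M show "c \<in> (\<lambda>(A, a). (norm (A *v x - a))\<^sup>2) ` {(A, a). augment A a \<in> ?U}"
      by (intro image_eqI[of _ _ "(A, a)"]) (auto simp: augment_mult_xtilde)
  qed (force simp: augment_mult_xtilde[symmetric])
  also have "\<dots> = ?F ` ?V"
    unfolding U image_image
    by (intro image_cong refl)
       (simp add: matrix_vector_mult_add_rdistrib augment_mult_xtilde
         id_kron_row_mult_vec_rows[of _ "unvec_rows _", simplified] add.commute)
  finally show ?thesis
    unfolding worst_case_residual_def by (rule arg_cong[of _ _ Sup])
qed

text \<open>The epigraph of the worst-case residual is the projection of the semidefinite feasible
  set that forgets the multipliers.\<close>

lemma worst_case_residual_le_iff:
  fixes A0 :: "real^'n^'k" and w :: "nat \<Rightarrow> real^('k \<times> 'n option)"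
  assumes dim: "CARD('k) \<ge> dim (span (w ` {1..l})) + 1"
    and slater: "frob_norm (D - Dbar) < \<rho>" "\<forall>j\<in>{1..l}. w j \<bullet> vec_rows D < \<beta> j"
  shows "worst_case_residual (uncertainty_set (augment A0 a0) Dbar \<rho> l w \<beta>) x \<le> lam \<longleftrightarrow>
    (\<exists>\<mu>. sdp_feasible A0 a0 (vec_rows Dbar) (\<rho>\<^sup>2) l w \<beta> (x, lam, \<mu>))"
proof -
  define b where "b = vec_rows Dbar"
  define q where "q = A0 *v x - a0"
  define L where "L = (*v) (id_kron_row (xtilde x) :: real^('k \<times> 'n option)^'k)"
  define V where "V = {v. norm (v - b) \<le> \<rho> \<and> (\<forall>j\<in>{1..l}. w j \<bullet> v \<le> \<beta> j)}"
  have v0: "norm (vec_rows D - b) < \<rho>"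
    using slater(1) by (simp add: frob_norm_eq_norm_vec_rows vec_rows_diff b_def)
  have "V \<noteq> {}" using v0 slater(2) by (auto simp: V_def intro!: exI[of _ "vec_rows D"] less_imp_le)
  have L: "linear L" by (simp add: L_def)
  \<comment> \<open>Comparing a real supremum with \<open>lam\<close> requires bounded values;
    continuity on a compact ball provides this.\<close>
  have "V \<subseteq> cball b \<rho>" by (auto simp: V_def dist_norm norm_minus_commute)
  moreover have "compact ((\<lambda>v. (norm (L v + q))\<^sup>2) ` cball b \<rho>)"
    by (intro compact_continuous_image continuous_intros linear_continuous_on compact_cball)
       (use L linear_conv_bounded_linear in blast)
  ultimately have "bdd_above ((\<lambda>v. (norm (L v + q))\<^sup>2) ` V)"
    by (meson bdd_above_mono bounded_imp_bdd_above compact_imp_bounded image_mono)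
  then have "worst_case_residual (uncertainty_set (augment A0 a0) Dbar \<rho> l w \<beta>) x \<le> lam \<longleftrightarrow>
      (\<forall>v\<in>V. (norm (L v + q))\<^sup>2 \<le> lam)"
    unfolding worst_case_residual_vectorized L_def[symmetric] q_def[symmetric] b_def[symmetric]
      V_def[symmetric]
    using \<open>V \<noteq> {}\<close> by (rule cSUP_le_iff[rotated])
  also have "\<dots> \<longleftrightarrow> (\<exists>\<mu>. (\<forall>j\<in>{0..l}. 0 \<le> \<mu> j) \<and>
    (\<forall>v. 0 \<le> lam - (norm (L v + q))\<^sup>2 + \<mu> 0 * ((norm (v - b))\<^sup>2 - \<rho>\<^sup>2) +
      (\<Sum>j = 1..l. \<mu> j * (w j \<bullet> v - \<beta> j))))" (is "?primal \<longleftrightarrow> ?dual")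
  proof
    assume ?primal
    have "\<exists>\<nu>\<ge>0. \<exists>\<mu>. (\<forall>j\<in>{1..l}. 0 \<le> \<mu> j) \<and>
      (\<forall>v. 0 \<le> lam - (norm (L v + q))\<^sup>2 + \<nu> * ((norm (v - b))\<^sup>2 - \<rho>\<^sup>2) +
        (\<Sum>j = 1..l. \<mu> j * (w j \<bullet> v - \<beta> j)))"
    proof (rule ball_polyhedron_multipliers[OF L])
      show "L (adjoint L z) = (norm (xtilde x))\<^sup>2 *\<^sub>R z" for z
        by (simp only: L_def adjoint_matrix id_kron_row_mult_transpose)
      show "(norm (L v + q))\<^sup>2 \<le> lam"
        if "norm (v - b) \<le> \<rho>" "\<forall>j\<in>{1..l}. w j \<bullet> v \<le> \<beta> j" for v
        using \<open>?primal\<close> that by (simp add: V_def)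
    qed (use dim v0 slater(2) xtilde_nonzero in auto)
    then obtain \<nu> \<mu> where \<nu>: "0 \<le> \<nu>" "\<forall>j\<in>{1..l}. 0 \<le> \<mu> j"
      "\<forall>v. 0 \<le> lam - (norm (L v + q))\<^sup>2 + \<nu> * ((norm (v - b))\<^sup>2 - \<rho>\<^sup>2) +
        (\<Sum>j = 1..l. \<mu> j * (w j \<bullet> v - \<beta> j))" by blast
    \<comment> \<open>Index \<open>0\<close> lies outside \<open>{1..l}\<close>, so it can store the
      ball multiplier without changing the sum.\<close>
    have "(\<Sum>j = 1..l. (\<mu>(0 := \<nu>)) j * (w j \<bullet> v - \<beta> j)) = (\<Sum>j = 1..l. \<mu> j * (w j \<bullet> v - \<beta> j))"
      for v
      by (intro sum.cong) auto
    with \<nu> show ?dual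
      by (intro exI[of _ "\<mu>(0 := \<nu>)"]) auto
  next
    assume ?dual
    then obtain \<mu> where \<mu>: "\<forall>j\<in>{0..l}. 0 \<le> \<mu> j"
      "\<And>v. 0 \<le> lam - (norm (L v + q))\<^sup>2 + \<mu> 0 * ((norm (v - b))\<^sup>2 - \<rho>\<^sup>2) +
        (\<Sum>j = 1..l. \<mu> j * (w j \<bullet> v - \<beta> j))" by blast
    show ?primal
    proof
      fix v assume v: "v \<in> V"
      \<comment> \<open>Weak duality: at a feasible point every penalty term is nonpositive.\<close>
      have "\<mu> 0 * ((norm (v - b))\<^sup>2 - \<rho>\<^sup>2) \<le> 0"
        using \<mu>(1) v by (intro mult_nonneg_nonpos) (auto simp: V_def intro: power_mono)
      moreover have "(\<Sum>j = 1..l. \<mu> j * (w j \<bullet> v - \<beta> j)) \<le> 0"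
        using \<mu>(1) v by (intro sum_nonpos mult_nonneg_nonpos) (auto simp: V_def)
      ultimately show "(norm (L v + q))\<^sup>2 \<le> lam"
        using \<mu>(2)[of v] by linarith
    qed
  qed
  also have "\<dots> \<longleftrightarrow> (\<exists>\<mu>. sdp_feasible A0 a0 (vec_rows Dbar) (\<rho>\<^sup>2) l w \<beta> (x, lam, \<mu>))"
    by (simp add: sdp_feasible_def psd_sdp_matrix_iff L_def q_def b_def)
  finally show ?thesis .
qed

theorem theorem5p1:
  fixes A0 :: "real^'n^'k" and a0 :: "real^'k"
    and Dbar :: "real^('n option)^'k" and \<rho> :: real
    and l :: nat and w :: "nat \<Rightarrow> real^('k \<times> 'n option)" and \<beta> :: "nat \<Rightarrow> real"
    and x :: "real^'n"
  assumes "CARD('k) \<ge> dim (span (w ` {1..l})) + 1"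
    and "{D :: real^('n option)^'k. frob_norm (D - Dbar) < \<rho> \<and>
           (\<forall>j\<in>{1..l}. w j \<bullet> vec_rows D < \<beta> j)} \<noteq> {}"
  shows "solves_RLSP (uncertainty_set (augment A0 a0) Dbar \<rho> l w \<beta>) x \<longleftrightarrow>
    (\<exists>lam \<mu>. (\<forall>j\<in>{0..l}. 0 \<le> \<mu> j) \<and>
       solves_SDP A0 a0 (vec_rows Dbar) (\<rho>\<^sup>2) l w \<beta> (x, lam, \<mu>))"
proof -
  let ?F = "worst_case_residual (uncertainty_set (augment A0 a0) Dbar \<rho> l w \<beta>)"
  let ?feas = "sdp_feasible A0 a0 (vec_rows Dbar) (\<rho>\<^sup>2) l w \<beta>"
  obtain D where D: "frob_norm (D - Dbar) < \<rho>" "\<forall>j\<in>{1..l}. w j \<bullet> vec_rows D < \<beta> j"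
    using assms(2) by blast
  have le_iff: "?F y \<le> lam \<longleftrightarrow> (\<exists>\<mu>. ?feas (y, lam, \<mu>))" for y lam
    by (rule worst_case_residual_le_iff[OF assms(1) D])
  have "solves_RLSP (uncertainty_set (augment A0 a0) Dbar \<rho> l w \<beta>) x \<longleftrightarrow> (\<forall>y. ?F x \<le> ?F y)"
    by (auto simp: solves_RLSP_def is_arg_min_def not_less)
  \<comment> \<open>Forwards, \<open>lam = ?F x\<close> is attained by \<open>le_iff\<close>.
    Backwards, every \<open>?F y\<close> is itself a feasible value, so
    \<open>?F x \<le> lam \<le> ?F y\<close>.\<close>
  also have "\<dots> \<longleftrightarrow> (\<exists>lam \<mu>. ?feas (x, lam, \<mu>) \<and> (\<forall>y lam' \<mu>'. ?feas (y, lam', \<mu>') \<longrightarrow> lam \<le> lam'))"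
    by (meson le_iff order_refl order_trans)
  also have "\<dots> \<longleftrightarrow> (\<exists>lam \<mu>. (\<forall>j\<in>{0..l}. 0 \<le> \<mu> j) \<and>
       solves_SDP A0 a0 (vec_rows Dbar) (\<rho>\<^sup>2) l w \<beta> (x, lam, \<mu>))"
  proof -
    have "?feas (x, lam, \<mu>) \<Longrightarrow> \<forall>j\<in>{0..l}. 0 \<le> \<mu> j" for lam \<mu>
      by (simp add: sdp_feasible_def)
    then show ?thesis
      unfolding solves_SDP_def is_arg_min_def by (simp add: not_less split_paired_All) blast
  qed
  finally show ?thesis .
qed

end
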